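(* Let $0 < s < t \leq 1$. Then there exist a uniformly discrete unbounded set $X \subseteq \mathbb{R}^2$ and non-empty disjoint open sets $I_s$ and $I_t$ in $G(2,1)$ such that (1) $\dim_{\mathrm{A}}^{\theta} P_V X = s$ for all $\theta \in (0,1)$ and all $V \in I_s$, (2) $\dim_{\mathrm{A}}^{\theta} P_V X = t$ for all $\theta \in (0,1)$ and all $V \in I_t$.
   Context: A set $X \subseteq \mathbb{R}^d$ is uniformly discrete if there exists $\delta>0$ such that $|x-y| \geq \delta$ for all distinct $x,y \in X$. $G(2,1)$ is the Grassmannian of $1$-dimensional linear subspaces $V \subseteq \mathbb{R}^2$ with its usual topology (induced by the acute angle between lines). $P_V \colon \mathbb{R}^2 \to V$ is orthogonal projection onto $V$, and $V$ is identified with $\mathbb{R}$. $B(x,R)$ is the closed ball with centre $x$ and radius $R$. $N_r(A)$ is the smallest number of closed balls of radius $r>0$ needed to cover the bounded set $A$. Assouad spectrum: for $X \subseteq \mathbb{R}^m$ and $\theta \in (0,1)$, $\dim_{\mathrm{A}}^\theta X$ is the infimum of all $\alpha \geq 0$ for which there exists a constant $C>0$ such that $N_{R^{1/\theta}}(X \cap B(x,R)) \leq C (R/R^{1/\theta})^\alpha$ for all $0<R<1$ and all $x \in X$. *)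

theory Defs
  imports "HOL-Analysis.Analysis"
begin

definition G21 :: "(real^2) set set" where
  "G21 = {V. subspace V \<and> dim V = 1}"

text \<open>A unit vector spanning the line \<^term>\<open>V\<close>. The only other choice is its negative.\<close>

definition unit_dir :: "(real^2) set \<Rightarrow> real^2" where
  "unit_dir V = (SOME u. u \<in> V \<and> norm u = 1)"

text \<open>The acute angle between two lines, in the interval from 0 to \<open>pi / 2\<close>; the absolute value
  makes it independent of the choice of the unit vectors. The value 0 outside \<^term>\<open>G21\<close> is only
  there because \<^locale>\<open>Metric_space\<close> asks for a distance that is nonnegative everywhere.\<close>

definition line_angle :: "(real^2) set \<Rightarrow> (real^2) set \<Rightarrow> real" where
  "line_angle V W = (if V \<in> G21 \<and> W \<in> G21 then arccos \<bar>unit_dir V \<bullet> unit_dir W\<bar> else 0)"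

definition G21_topology :: "(real^2) set topology" where
  "G21_topology = Metric_space.mtopology G21 line_angle"

lemma unit_dir:
  assumes "V \<in> G21"
  shows unit_dir_in: "unit_dir V \<in> V" and norm_unit_dir: "norm (unit_dir V) = 1"
    and span_unit_dir: "V = span {unit_dir V}"
proof -
  from assms have V: "subspace V" "dim V = 1" by (auto simp: G21_def)
  have "\<not> V \<subseteq> {0}" using V(2) by (metis dim_eq_0 zero_neq_one)
  then obtain v where v: "v \<in> V" "v \<noteq> 0" by auto
  have "v /\<^sub>R norm v \<in> V \<and> norm (v /\<^sub>R norm v) = 1"
    using v V(1) by (simp add: subspace_scale)
  then have *: "unit_dir V \<in> V \<and> norm (unit_dir V) = 1"
    unfolding unit_dir_def by (rule someI)
  then show 1: "unit_dir V \<in> V" and 2: "norm (unit_dir V) = 1" by auto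
  have "dim (span {unit_dir V}) = 1" using 2 by (auto simp: dim_insert)
  moreover have "span {unit_dir V} \<subseteq> V" using 1 V(1) by (simp add: span_minimal)
  ultimately show "V = span {unit_dir V}"
    using V by (metis subspace_dim_equal subspace_span order_refl)
qed

lemma abs_inner_unit_dir_le: "V \<in> G21 \<Longrightarrow> W \<in> G21 \<Longrightarrow> \<bar>unit_dir V \<bullet> unit_dir W\<bar> \<le> 1"
  using Cauchy_Schwarz_ineq2[of "unit_dir V" "unit_dir W"] by (simp add: norm_unit_dir)

lemma line_angle_triangle:
  assumes "U \<in> G21" "V \<in> G21" "W \<in> G21"
  shows "line_angle U W \<le> line_angle U V + line_angle V W"
proof -
  define u v w where "u = unit_dir U" and "v = unit_dir V" and "w = unit_dir W"
  define a b where "a = line_angle U V" and "b = line_angle V W"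
  have n: "u \<bullet> u = 1" "v \<bullet> v = 1" "w \<bullet> w = 1"
    using assms by (auto simp: u_def v_def w_def norm_unit_dir dot_square_norm)
  have le: "\<bar>u \<bullet> v\<bar> \<le> 1" "\<bar>v \<bullet> w\<bar> \<le> 1" "\<bar>u \<bullet> w\<bar> \<le> 1"
    using assms by (auto simp: u_def v_def w_def abs_inner_unit_dir_le)
  have ab: "a = arccos \<bar>u \<bullet> v\<bar>" "b = arccos \<bar>v \<bullet> w\<bar>"
    by (auto simp: a_def b_def u_def v_def w_def line_angle_def assms)
  have bds: "0 \<le> a" "a \<le> pi/2" "0 \<le> b" "b \<le> pi/2"
    using le arccos_le_pi2[of "\<bar>u \<bullet> v\<bar>"] arccos_le_pi2[of "\<bar>v \<bullet> w\<bar>"]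
    unfolding ab by (auto intro!: arccos_lbound)
  have cs: "cos a = \<bar>u \<bullet> v\<bar>" "cos b = \<bar>v \<bullet> w\<bar>"
    using le unfolding ab by (auto intro!: cos_arccos)
  have sn: "sin a = sqrt (1 - (u \<bullet> v)\<^sup>2)" "sin b = sqrt (1 - (v \<bullet> w)\<^sup>2)"
    using le unfolding ab by (auto simp: sin_arccos)
  define p q where "p = u - (u \<bullet> v) *\<^sub>R v" and "q = w - (v \<bullet> w) *\<^sub>R v"
  have np: "norm p = sin a" "norm q = sin b"
    unfolding sn norm_eq_sqrt_inner p_def q_def
    by (simp_all add: inner_diff_left inner_diff_right n power2_eq_square inner_commute)
  have pq: "p \<bullet> q = u \<bullet> w - (u \<bullet> v) * (v \<bullet> w)"
    unfolding p_def q_def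
    by (simp add: inner_diff_left inner_diff_right n inner_commute algebra_simps)
  have "\<bar>p \<bullet> q\<bar> \<le> sin a * sin b" using Cauchy_Schwarz_ineq2[of p q] np by simp
  then have "\<bar>u \<bullet> v\<bar> * \<bar>v \<bullet> w\<bar> - \<bar>u \<bullet> w\<bar> \<le> sin a * sin b"
    unfolding pq abs_mult[symmetric] by linarith
  then have "cos (a + b) \<le> \<bar>u \<bullet> w\<bar>" by (simp add: cos_add cs)
  then have "arccos \<bar>u \<bullet> w\<bar> \<le> arccos (cos (a + b))"
    using le by (intro arccos_le_arccos) auto
  also have "\<dots> = a + b" using bds by (intro arccos_cos) auto
  finally show ?thesis by (simp add: a_def b_def line_angle_def u_def w_def assms)
qed

interpretation G21: Metric_space G21 line_angle
  rewrites "Metric_space.mtopology G21 line_angle = G21_topology"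
proof -
  show "Metric_space G21 line_angle"
  proof
    show "line_angle V W = line_angle W V" for V W
      by (simp add: line_angle_def inner_commute)
    show "0 \<le> line_angle V W" for V W
      using abs_inner_unit_dir_le[of V W] by (auto simp: line_angle_def intro!: arccos_lbound)
    show "line_angle V W = 0 \<longleftrightarrow> V = W" if VW: "V \<in> G21" "W \<in> G21" for V W
    proof
      assume "V = W"
      then show "line_angle V W = 0"
        using VW by (simp add: line_angle_def dot_square_norm norm_unit_dir)
    next
      assume "line_angle V W = 0"
      then have "\<bar>unit_dir V \<bullet> unit_dir W\<bar> = 1"
        using VW abs_inner_unit_dir_le[OF VW] cos_arccos[of "\<bar>unit_dir V \<bullet> unit_dir W\<bar>"]
        by (simp add: line_angle_def)
      then have "unit_dir V = unit_dir W \<or> unit_dir V = - unit_dir W"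
        using norm_cauchy_schwarz_abs_eq[of "unit_dir V" "unit_dir W"] VW
        by (auto simp: norm_unit_dir)
      then have "unit_dir V \<in> W"
        using VW unit_dir_in[of W] by (auto simp: G21_def subspace_neg)
      then have "V \<subseteq> W"
        using VW span_unit_dir[of V] span_minimal[of "{unit_dir V}" W] by (auto simp: G21_def)
      then show "V = W"
        using VW subspace_dim_equal[of V W] by (simp add: G21_def)
    qed
  qed (rule line_angle_triangle)
qed (simp add: G21_topology_def)

definition orth_proj :: "(real^2) set \<Rightarrow> real^2 \<Rightarrow> real^2" where
  "orth_proj V x = (THE p. p \<in> V \<and> (\<forall>v\<in>V. (x - p) \<bullet> v = 0))"

text \<open>The orthogonal projection followed by the identification of the line with the reals that
  sends \<^term>\<open>unit_dir V\<close> to 1. The opposite unit vector would only reflect the image.\<close>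

definition line_proj :: "(real^2) set \<Rightarrow> real^2 \<Rightarrow> real" where
  "line_proj V x = (THE c. orth_proj V x = c *\<^sub>R unit_dir V)"

lemma orth_proj_eq:
  assumes "V \<in> G21"
  shows "orth_proj V x = (x \<bullet> unit_dir V) *\<^sub>R unit_dir V"
  unfolding orth_proj_def
proof (rule the_equality)
  let ?u = "unit_dir V"
  have u: "?u \<bullet> ?u = 1" using assms by (simp add: norm_unit_dir dot_square_norm)
  have V: "v \<in> V \<longleftrightarrow> (\<exists>k. v = k *\<^sub>R ?u)" for v
    using span_unit_dir[OF assms] by (metis UNIV_I image_iff span_singleton)
  show "(x \<bullet> ?u) *\<^sub>R ?u \<in> V \<and> (\<forall>v\<in>V. (x - (x \<bullet> ?u) *\<^sub>R ?u) \<bullet> v = 0)"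
    by (auto simp: V inner_diff_left u)
  show "p = (x \<bullet> ?u) *\<^sub>R ?u" if p: "p \<in> V \<and> (\<forall>v\<in>V. (x - p) \<bullet> v = 0)" for p
  proof -
    obtain k where k: "p = k *\<^sub>R ?u" using p V by blast
    have "(x - p) \<bullet> ?u = 0" using p unit_dir_in[OF assms] by blast
    then have "k = x \<bullet> ?u" by (simp add: k inner_diff_left u)
    then show ?thesis by (simp add: k)
  qed
qed

lemma line_proj_eq:
  assumes "V \<in> G21"
  shows "line_proj V x = x \<bullet> unit_dir V"
proof -
  have "unit_dir V \<noteq> 0" using norm_unit_dir[OF assms] by auto
  then show ?thesis unfolding line_proj_def orth_proj_eq[OF assms] by auto
qed

definition covering_number :: "real \<Rightarrow> 'a::metric_space set \<Rightarrow> nat" where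
  "covering_number r A = (LEAST n. \<exists>C. finite C \<and> card C = n \<and> A \<subseteq> (\<Union>c\<in>C. cball c r))"

text \<open>In \<open>\<real>\<^sup>m\<close> the exponent \<open>\<alpha> = m\<close> is always admissible, so the real infimum below is taken over
  a nonempty set that is bounded below.\<close>

definition assouad_spectrum :: "real \<Rightarrow> 'a::euclidean_space set \<Rightarrow> real" where
  "assouad_spectrum \<theta> X = Inf {\<alpha>. 0 \<le> \<alpha> \<and> (\<exists>C>0. \<forall>R x. 0 < R \<and> R < 1 \<and> x \<in> X \<longrightarrow>
     real (covering_number (R powr (1 / \<theta>)) (X \<inter> cball x R)) \<le> C * (R / R powr (1 / \<theta>)) powr \<alpha>)}"

end

(* For b = 2 powr (1/s), the sums of distinct powers of b below b^n form a 1-separated Cantor-like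
   set of dimension s at all scales. The set X consists of copies of these sets, with b taken from
   s or from t, placed very sparsely along the diagonal, so that in directions not nearly
   orthogonal to the diagonal the projections of different copies stay apart. A copy projects to
   a line as a dilation of the Cantor set: by a factor bounded below if its direction is transverse
   to the kernel of the projection, which makes the copy invisible at scales below 1, and by an
   arbitrarily small factor if its direction is almost in the kernel. The copies built from t are
   given all rational directions in a cone around the second axis, and those built from s all
   rational directions in a cone around the first axis; thus lines close to the first axis see
   only the copies built from t, and lines close to the second axis only those built from s. *)

theory Submission
  imports Defs
begin

section \<open>Digit sums: separation, counting and covering\<close>

text \<open>Horner form: each step shifts the digits up and appends a lowest digit 0 or 1, so
  inductions peel off the lowest digit.\<close>

primrec digit_sums :: "real \<Rightarrow> nat \<Rightarrow> real set" where
  "digit_sums b 0 = {0}"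
| "digit_sums b (Suc n) = (\<lambda>x. b * x) ` digit_sums b n \<union> (\<lambda>x. b * x + 1) ` digit_sums b n"

lemma finite_digit_sums: "finite (digit_sums b n)"
  by (induction n) auto

lemma zero_in_digit_sums: "0 \<in> digit_sums b n"
  by (induction n) force+

lemma digit_sums_bounds:
  assumes "b \<ge> 2" "e \<in> digit_sums b n"
  shows "0 \<le> e" "e \<le> b ^ n - 1"
proof -
  have "0 \<le> e \<and> e \<le> b ^ n - 1" using assms(2)
  proof (induction n arbitrary: e)
    case (Suc n)
    then obtain x where x: "x \<in> digit_sums b n" "e = b * x \<or> e = b * x + 1" by auto
    have "0 \<le> b * x" "b * x \<le> b * (b ^ n - 1)"
      using Suc.IH[OF x(1)] assms(1) by (auto intro!: mult_left_mono)
    with x(2) assms(1) show ?case by (auto simp: algebra_simps)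
  qed simp
  then show "0 \<le> e" "e \<le> b ^ n - 1" by auto
qed

text \<open>If the parts above the lowest digit differ, multiplication by \<open>b\<close> puts them
  at least 2 apart; the lowest digits take back at most 1.\<close>

lemma digit_sums_separated:
  assumes "b \<ge> 2" "e \<in> digit_sums b n" "f \<in> digit_sums b n" "e \<noteq> f"
  shows "\<bar>e - f\<bar> \<ge> 1"
  using assms(2-)
proof (induction n arbitrary: e f)
  case (Suc n)
  obtain x where x: "x \<in> digit_sums b n" "e = b * x \<or> e = b * x + 1" using Suc.prems by auto
  obtain y where y: "y \<in> digit_sums b n" "f = b * y \<or> f = b * y + 1" using Suc.prems by auto
  show ?case
  proof (cases "x = y")
    case True
    then show ?thesis using x y Suc.prems by auto
  next
    case False
    then have "b * \<bar>x - y\<bar> \<ge> 2 * 1" using Suc.IH[OF x(1) y(1)] assms(1)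
      by (intro mult_mono) auto
    then have "\<bar>b * x - b * y\<bar> \<ge> 2"
      using assms(1) by (simp add: abs_mult flip: right_diff_distrib)
    then show ?thesis using x(2) y(2) by auto
  qed
qed auto

lemma card_digit_sums:
  assumes "b \<ge> 2"
  shows "card (digit_sums b n) = 2 ^ n"
proof (induction n)
  case (Suc n)
  have "b * x \<noteq> b * y + 1" if "x \<in> digit_sums b n" "y \<in> digit_sums b n" for x y
  proof (cases "x = y")
    case False
    then have "b * \<bar>x - y\<bar> \<ge> 2 * 1" using digit_sums_separated[OF assms that] assms
      by (intro mult_mono) auto
    then have "\<bar>b * x - b * y\<bar> \<ge> 2"
      using assms by (simp add: abs_mult flip: right_diff_distrib)
    then show ?thesis by auto
  qed auto
  then have "(\<lambda>x. b * x) ` digit_sums b n \<inter> (\<lambda>x. b * x + 1) ` digit_sums b n = {}" by blast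
  moreover have "inj_on (\<lambda>x. b * x) A" "inj_on (\<lambda>x. b * x + 1) A" for A
    using assms by (auto simp: inj_on_def)
  ultimately show ?case
    by (simp add: card_Un_disjoint finite_digit_sums card_image Suc.IH)
qed simp

lemma card_separated_le:
  fixes S :: "real set"
  assumes "S \<subseteq> {x..x + L}" "L \<ge> 0" "\<And>y z. y \<in> S \<Longrightarrow> z \<in> S \<Longrightarrow> y \<noteq> z \<Longrightarrow> \<bar>y - z\<bar> \<ge> 1"
  shows "finite S" "real (card S) \<le> L + 1"
proof -
  have inj: "inj_on (\<lambda>y. \<lfloor>y - x\<rfloor>) S"
  proof (rule inj_onI, rule ccontr)
    fix y z assume *: "y \<in> S" "z \<in> S" "\<lfloor>y - x\<rfloor> = \<lfloor>z - x\<rfloor>" "y \<noteq> z"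
    have "\<bar>(y - x) - (z - x)\<bar> < 1" using *(3) by linarith
    then show False using assms(3)[OF *(1,2,4)] by simp
  qed
  have sub: "(\<lambda>y. \<lfloor>y - x\<rfloor>) ` S \<subseteq> {0..\<lfloor>L\<rfloor>}"
    using assms(1) by (auto intro!: floor_mono simp: subset_iff)
  show fin: "finite S" using inj sub finite_subset finite_imageD by blast
  have "card S \<le> card {0..\<lfloor>L\<rfloor>}" using inj sub by (intro card_inj_on_le) auto
  then show "real (card S) \<le> L + 1" using assms(2) by (simp; linarith)
qed

text \<open>Splitting by the lowest digit replaces an interval of length \<open>L\<close> by two of
  length \<open>L / b\<close>, and \<open>b powr s = 2\<close> halves \<open>L powr s\<close>. The
  bound thus reproduces itself with a constant independent of \<open>n\<close>; below length
  \<open>b\<close>, 1-separation suffices.\<close>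

lemma card_digit_sums_interval_le:
  assumes s: "0 < s" and b: "b = 2 powr (1 / s)" "b \<ge> 2" and L: "L \<ge> 1"
  shows "real (card (digit_sums b n \<inter> {x..x + L})) \<le> (b + 1) * L powr s"
  using L
proof (induction n arbitrary: x L)
  case 0
  have "card (digit_sums b 0 \<inter> {x..x + L}) \<le> card {0::real}"
    by (intro card_mono) auto
  moreover have "1 * 1 \<le> (b + 1) * L powr s"
    using 0 b s by (intro mult_mono) (auto simp: ge_one_powr_ge_zero)
  ultimately show ?case by simp
next
  case (Suc n)
  show ?case
  proof (cases "L < b")
    case True
    have "real (card (digit_sums b (Suc n) \<inter> {x..x + L})) \<le> L + 1"
      using Suc.prems digit_sums_separated[OF b(2)]
      by (intro card_separated_le(2)[of _ x]) (blast, simp, blast)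
    also have "\<dots> \<le> (b + 1) * 1" using True by simp
    also have "\<dots> \<le> (b + 1) * L powr s"
      using Suc.prems b s by (intro mult_left_mono) (auto simp: ge_one_powr_ge_zero)
    finally show ?thesis .
  next
    case False
    let ?I = "\<lambda>y. digit_sums b n \<inter> {y / b..y / b + L / b}"
    have "digit_sums b (Suc n) \<inter> {x..x + L} \<subseteq> (\<lambda>x. b * x) ` ?I x \<union> (\<lambda>x. b * x + 1) ` ?I (x - 1)"
      using b by (auto simp: field_simps)
    then have "card (digit_sums b (Suc n) \<inter> {x..x + L})
      \<le> card ((\<lambda>x. b * x) ` ?I x \<union> (\<lambda>x. b * x + 1) ` ?I (x - 1))"
      by (intro card_mono) (auto simp: finite_digit_sums)
    also have "\<dots> \<le> card (?I x) + card (?I (x - 1))"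
      by (intro order.trans[OF card_Un_le] add_mono card_image_le) (auto simp: finite_digit_sums)
    finally have "real (card (digit_sums b (Suc n) \<inter> {x..x + L}))
      \<le> real (card (?I x)) + real (card (?I (x - 1)))" by linarith
    also have "\<dots> \<le> (b + 1) * (L / b) powr s + (b + 1) * (L / b) powr s"
      using False b by (intro add_mono Suc.IH) auto
    also have "(L / b) powr s = L powr s / 2"
      using s b Suc.prems by (simp add: powr_divide powr_powr)
    finally show ?thesis by simp
  qed
qed

text \<open>\<open>c\<close> keeps the top \<open>m\<close> digits; the \<open>i\<close> dropped
  ones contribute at most \<open>b ^ i - 1\<close>.\<close>

lemma digit_sums_coarse:
  assumes b: "b \<ge> 2" and "e \<in> digit_sums b (m + i)"
  shows "\<exists>c\<in>digit_sums b m. b ^ i * c \<le> e \<and> e \<le> b ^ i * c + (b ^ i - 1)"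
  using assms(2)
proof (induction i arbitrary: e)
  case (Suc i)
  then obtain x where x: "x \<in> digit_sums b (m + i)" "e = b * x \<or> e = b * x + 1" by auto
  obtain c where c: "c \<in> digit_sums b m" "b ^ i * c \<le> x" "x \<le> b ^ i * c + (b ^ i - 1)"
    using Suc.IH[OF x(1)] by auto
  define y z where "y = b * x" and "z = b ^ Suc i * c"
  have "b * (b ^ i * c) \<le> b * x" "b * x \<le> b * (b ^ i * c + (b ^ i - 1))"
    using c b by (auto intro!: mult_left_mono)
  then have "z \<le> y" "y \<le> z + b ^ Suc i - b" by (simp_all add: y_def z_def algebra_simps)
  then have "z \<le> e" "e \<le> z + (b ^ Suc i - 1)" using x(2) b by (auto simp: y_def[symmetric])
  then show ?case using c(1) by (auto simp: z_def)
qed auto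

text \<open>At scales below 1 the points themselves serve as centres; at larger scales the digits
  below the scale \<open>r\<close> are dropped first. The constant is uniform in \<open>n\<close>
  and in the scales.\<close>

lemma digit_sums_cover:
  assumes s: "0 < s" and b: "b = 2 powr (1 / s)" "b \<ge> 2" and r: "0 < r" "r \<le> R"
  shows "\<exists>C. finite C \<and> real (card C) \<le> (b + 1) * (4 * b) powr s * (R / r) powr s \<and>
    digit_sums b n \<inter> cball x R \<subseteq> (\<Union>c\<in>C. cball c r)"
proof (cases "r < 1")
  case True
  \<comment> \<open>The length \<open>4 * R / r\<close> is at least \<open>2 * R\<close>, the length
    of the ball, since \<open>r < 1\<close>, and at least 1, as the counting bound requires.\<close>
  let ?C = "digit_sums b n \<inter> {x - R..(x - R) + 4 * R / r}"
  have "2 * R * r \<le> 4 * R" using r True mult_left_mono[of r 1 "2*R"] by auto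
  then have le: "2 * R \<le> 4 * R / r" using r by (simp add: field_simps)
  have "1 \<le> 4 * R / r" using r by simp
  from card_digit_sums_interval_le[OF s b this]
  have "real (card ?C) \<le> (b + 1) * (4 * R / r) powr s" .
  also have "\<dots> \<le> (b + 1) * ((4 * b) * (R / r)) powr s"
    using b r s by (intro mult_left_mono powr_mono2) (auto simp: field_simps)
  also have "\<dots> = (b + 1) * (4 * b) powr s * (R / r) powr s"
    using powr_mult[of "4 * b" "R / r" s] b(2) r by simp
  finally show ?thesis using le r
    by (intro exI[of _ ?C]) (force simp: finite_digit_sums dist_real_def)
next
  case False
  have "\<exists>n. r < b ^ n" using b by (intro real_arch_pow) auto
  then obtain j where j: "r < b ^ j" "\<And>i. i < j \<Longrightarrow> \<not> r < b ^ i"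
    using exists_least_iff[of "\<lambda>n. r < b ^ n"] by blast
  with False have "j \<noteq> 0" by (intro notI) auto
  then obtain i where i: "j = Suc i" by (cases j) auto
  have bi: "b ^ i \<le> r" "r < b * b ^ i" "0 < b ^ i" using j(2)[of i] j(1) i b by auto
  show ?thesis
  proof (cases "i \<le> n")
    case True
    have R: "R \<ge> 0" using r by linarith
    have "1 / b ^ i \<le> b / r" using bi r by (simp add: field_simps)
    then have "4 * R * (1 / b ^ i) \<le> 4 * R * (b / r)" using r by (intro mult_left_mono) auto
    then have le: "4 * R / b ^ i \<le> (4 * b) * (R / r)" by (simp add: mult_ac)
    \<comment> \<open>Truncation lowers a point by at most \<open>b ^ i - 1 < R\<close>, so the
      truncated points stay within \<open>2 * R\<close> of \<open>x\<close>; the interval is this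
      range divided by \<open>b ^ i\<close>.\<close>
    let ?C = "digit_sums b (n - i) \<inter> {(x - 2 * R) / b ^ i..(x - 2 * R) / b ^ i + 4 * R / b ^ i}"
    have "real (card ?C) \<le> (b + 1) * (4 * R / b ^ i) powr s"
      using bi r by (intro card_digit_sums_interval_le s b) (auto simp: field_simps)
    also have "\<dots> \<le> (b + 1) * ((4 * b) * (R / r)) powr s"
      using b(2) R s bi le by (intro mult_left_mono powr_mono2 divide_nonneg_nonneg) auto
    also have "\<dots> = (b + 1) * (4 * b) powr s * (R / r) powr s"
      using powr_mult[of "4 * b" "R / r" s] b(2) r by simp
    finally have 1: "real (card ?C) \<le> (b + 1) * (4 * b) powr s * (R / r) powr s" .
    have "\<exists>c\<in>?C. e \<in> cball (b ^ i * c) r" if e: "e \<in> digit_sums b n" "e \<in> cball x R" for e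
    proof -
      obtain c where c: "c \<in> digit_sums b (n - i)" "b ^ i * c \<le> e" "e \<le> b ^ i * c + (b ^ i - 1)"
        using digit_sums_coarse[OF b(2), of e "n - i" i] e True by auto
      moreover have "x - 2 * R \<le> b ^ i * c" "b ^ i * c \<le> x + 2 * R"
        using c e(2) bi r by (auto simp: dist_real_def)
      moreover from this have "(x - 2 * R) / b ^ i \<le> c" "c \<le> (x - 2 * R) / b ^ i + 4 * R / b ^ i"
        using bi by (simp_all add: pos_divide_le_eq pos_le_divide_eq mult.commute
            flip: add_divide_distrib)
      ultimately show ?thesis using bi by (intro bexI[of _ c]) (auto simp: dist_real_def)
    qed
    then have "digit_sums b n \<inter> cball x R \<subseteq> (\<Union>c\<in>(\<lambda>c. b ^ i * c) ` ?C. cball c r)" by blast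
    moreover have "card ((\<lambda>c. b ^ i * c) ` ?C) \<le> card ?C"
      by (intro card_image_le) (auto simp: finite_digit_sums)
    ultimately show ?thesis using 1
      by (intro exI[of _ "(\<lambda>c. b ^ i * c) ` ?C"]) (auto simp: finite_digit_sums)
  next
    case False
    then have "b ^ n \<le> b ^ i" using b by (intro power_increasing) auto
    then have "digit_sums b n \<subseteq> cball 0 r"
      using digit_sums_bounds[OF b(2)] bi by (fastforce simp: dist_real_def)
    moreover have "1 * 1 * 1 \<le> (b + 1) * (4 * b) powr s * (R / r) powr s"
      using b r s by (intro mult_mono) (auto simp: ge_one_powr_ge_zero)
    ultimately show ?thesis by (intro exI[of _ "{0}"]) auto
  qed
qed

section \<open>Covering numbers and dilated copies\<close>

lemma covering_number_le:
  assumes "finite C" "A \<subseteq> (\<Union>c\<in>C. cball c r)"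
  shows "covering_number r A \<le> card C"
  unfolding covering_number_def using assms by (intro Least_le) auto

text \<open>\<open>LEAST\<close> yields a true minimum only when some finite cover exists; total
  boundedness of the compact closure provides one.\<close>

lemma covering_number_attained:
  fixes A :: "'a::heine_borel set"
  assumes "bounded A" "0 < r"
  obtains C where "finite C" "card C = covering_number r A" "A \<subseteq> (\<Union>c\<in>C. cball c r)"
proof -
  have "compact (closure A)" using assms by (simp add: compact_closure)
  then obtain K where K: "finite K" "closure A \<subseteq> (\<Union>x\<in>K. ball x r)"
    using assms(2) unfolding compact_eq_totally_bounded by blast
  have "A \<subseteq> (\<Union>c\<in>K. cball c r)"
    using K(2) closure_subset[of A] ball_subset_cball[of _ r] by blast
  then have "\<exists>n C. finite C \<and> card C = n \<and> A \<subseteq> (\<Union>c\<in>C. cball c r)" using K(1) by blast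
  from LeastI_ex[OF this] show ?thesis using that unfolding covering_number_def by blast
qed

text \<open>Division by \<open>\<bar>l\<bar>\<close> keeps the ratio \<open>R / r\<close>, so the
  constant is uniform in \<open>p\<close>, \<open>l\<close> and \<open>n\<close>, however strongly
  the copy is contracted.\<close>

lemma affine_digit_sums_cover:
  assumes s: "0 < s" and b: "b = 2 powr (1 / s)" "b \<ge> 2" and r: "0 < r" "r \<le> R"
  shows "\<exists>C. finite C \<and> real (card C) \<le> (b + 1) * (4 * b) powr s * (R / r) powr s \<and>
    (\<lambda>e. p + l * e) ` digit_sums b n \<inter> cball y R \<subseteq> (\<Union>c\<in>C. cball c r)"
proof (cases "l = 0")
  case True
  have "1 * 1 * 1 \<le> (b + 1) * (4 * b) powr s * (R / r) powr s"
    using b r s by (intro mult_mono) (auto simp: ge_one_powr_ge_zero)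
  then show ?thesis using True r by (intro exI[of _ "{p}"]) auto
next
  case False
  obtain C where C: "finite C" "real (card C) \<le> (b + 1) * (4 * b) powr s * ((R / \<bar>l\<bar>) / (r / \<bar>l\<bar>)) powr s"
    "digit_sums b n \<inter> cball ((y - p) / l) (R / \<bar>l\<bar>) \<subseteq> (\<Union>c\<in>C. cball c (r / \<bar>l\<bar>))"
    using digit_sums_cover[OF s b, of "r / \<bar>l\<bar>" "R / \<bar>l\<bar>"] False r
    by (metis divide_pos_pos divide_right_mono abs_ge_zero zero_less_abs_iff)
  have scale: "p + l * e \<in> cball (p + l * c) q \<longleftrightarrow> e \<in> cball c (q / \<bar>l\<bar>)" for e c q
  proof -
    have "\<bar>p + l * c - (p + l * e)\<bar> = \<bar>l\<bar> * \<bar>c - e\<bar>"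
      by (simp flip: abs_mult add: algebra_simps)
    then show ?thesis using False by (simp add: dist_real_def field_simps)
  qed
  have "\<exists>c\<in>C. p + l * e \<in> cball (p + l * c) r"
    if "e \<in> digit_sums b n" "p + l * e \<in> cball y R" for e
  proof -
    have "e \<in> cball ((y - p) / l) (R / \<bar>l\<bar>)"
      using that(2) scale[of e "(y - p) / l" R] False by simp
    then show ?thesis using C(3) that(1) unfolding scale by blast
  qed
  then have "(\<lambda>e. p + l * e) ` digit_sums b n \<inter> cball y R \<subseteq> (\<Union>c\<in>(\<lambda>c. p + l * c) ` C. cball c r)"
    by blast
  moreover have "real (card ((\<lambda>c. p + l * c) ` C)) \<le> (b + 1) * (4 * b) powr s * (R / r) powr s"
    using C(2) card_image_le[OF C(1), of "\<lambda>c. p + l * c"] False by simp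
  ultimately show ?thesis using C(1) by (intro exI[of _ "(\<lambda>c. p + l * c) ` C"]) auto
qed

lemma card_affine_digit_sums_le:
  assumes b: "b \<ge> 2" and l: "l \<noteq> 0" and R: "R \<ge> 0"
  shows "real (card ((\<lambda>e. p + l * e) ` digit_sums b n \<inter> cball y R)) \<le> 2 * R / \<bar>l\<bar> + 1"
proof -
  let ?S = "(\<lambda>e. p + l * e) ` digit_sums b n \<inter> cball y R"
  let ?f = "\<lambda>z. z / \<bar>l\<bar>"
  have "real (card (?f ` ?S)) \<le> 2 * R / \<bar>l\<bar> + 1"
  proof (rule card_separated_le(2))
    show "?f ` ?S \<subseteq> {(y - R) / \<bar>l\<bar>..(y - R) / \<bar>l\<bar> + 2 * R / \<bar>l\<bar>}"
      using l by (auto simp: dist_real_def divide_right_mono abs_le_iff simp flip: add_divide_distrib)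
    show "\<bar>u - v\<bar> \<ge> 1" if uv: "u \<in> ?f ` ?S" "v \<in> ?f ` ?S" "u \<noteq> v" for u v
    proof -
      obtain e f where ef: "e \<in> digit_sums b n" "f \<in> digit_sums b n"
        "u = (p + l * e) / \<bar>l\<bar>" "v = (p + l * f) / \<bar>l\<bar>" using uv by auto
      then have "u - v = (l * (e - f)) / \<bar>l\<bar>"
        by (simp add: right_diff_distrib flip: diff_divide_distrib)
      then have "\<bar>u - v\<bar> = \<bar>e - f\<bar>" using l by (simp add: abs_mult)
      moreover have "e \<noteq> f" using uv(3) ef by auto
      ultimately show ?thesis using digit_sums_separated[OF b ef(1,2)] by simp
    qed
  qed (use R in auto)
  moreover have "card (?f ` ?S) = card ?S" using l by (intro card_image) (auto simp: inj_on_def)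
  ultimately show ?thesis by simp
qed

section \<open>Assouad spectrum of a union of separated clusters\<close>

lemma two_powr_inverse_ge_2:
  fixes s :: real
  assumes "0 < s" "s \<le> 1"
  shows "2 powr (1 / s) \<ge> 2"
proof -
  have "(2::real) powr 1 \<le> 2 powr (1 / s)" using assms by (intro powr_mono) auto
  then show ?thesis by simp
qed

text \<open>Abstract form of a projection: cluster \<open>k\<close> sits at \<open>p k\<close> and
  is dilated by \<open>l k\<close>. By \<open>sep\<close>, a ball of radius below 1 centred in the
  union meets only one cluster. By \<open>alt\<close>, this cluster has the right base, which gives
  exponent \<open>s\<close>, or boundedly many points in the ball. By \<open>rich\<close>, clusters
  of the right base occur with any number of digits at any small spacing, which gives the lower
  bound.\<close>

lemma assouad_spectrum_clusters:
  fixes p l B :: "nat \<Rightarrow> real" and N :: "nat \<Rightarrow> nat"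
  defines "K \<equiv> \<lambda>k. (\<lambda>e. p k + l k * e) ` digit_sums (B k) (N k)"
  assumes s: "0 < s" "s \<le> 1" and b: "b = 2 powr (1 / s)" and \<theta>: "0 < \<theta>" "\<theta> < 1"
    and B: "\<And>k. B k \<ge> 2"
    and sep: "\<And>j k y z. j \<noteq> k \<Longrightarrow> y \<in> K j \<Longrightarrow> z \<in> K k \<Longrightarrow> \<bar>y - z\<bar> \<ge> 1"
    and alt: "\<And>k. B k = b \<or> \<bar>l k\<bar> \<ge> 1/4"
    and rich: "\<And>m r. 0 < r \<Longrightarrow> r \<le> 1/4 \<Longrightarrow> \<exists>k. B k = b \<and> N k = m \<and> r / 2 \<le> \<bar>l k\<bar> \<and> \<bar>l k\<bar> \<le> r"
  shows "assouad_spectrum \<theta> (\<Union>k. K k) = s"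
proof -
  note b2 = two_powr_inverse_ge_2[OF s, folded b]
  \<comment> \<open>The covering constant for base \<open>b\<close> plus
    \<open>9 = 2 / (1/4) + 1\<close>, the bound on the points in a ball of radius below 1 when
    \<open>\<bar>l k\<bar> \<ge> 1/4\<close>.\<close>
  define M where "M = (b + 1) * (4 * b) powr s + 9"
  have M: "M \<ge> 9" using b2 by (simp add: M_def)
  have up: "real (covering_number (R powr (1 / \<theta>)) ((\<Union>k. K k) \<inter> cball x R))
      \<le> M * (R / R powr (1 / \<theta>)) powr s"
    if R: "0 < R" "R < 1" and x: "x \<in> (\<Union>k. K k)" for R x
  proof -
    define r where "r = R powr (1 / \<theta>)"
    have "R powr (1 / \<theta>) \<le> R powr 1" using R \<theta> by (intro powr_mono') auto
    then have r: "0 < r" "r \<le> R" using R by (auto simp: r_def)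
    have Rr: "(R / r) powr s \<ge> 1" using r s by (intro ge_one_powr_ge_zero) auto
    obtain k where k: "x \<in> K k" using x by auto
    have "(\<Union>k. K k) \<inter> cball x R = K k \<inter> cball x R"
      using sep[OF _ _ k] R by (fastforce simp: dist_real_def abs_minus_commute)
    moreover have "\<exists>C. finite C \<and> real (card C) \<le> M * (R / r) powr s \<and>
      K k \<inter> cball x R \<subseteq> (\<Union>c\<in>C. cball c r)"
    proof (cases "B k = b")
      case True
      obtain C where "finite C" "real (card C) \<le> (b + 1) * (4 * b) powr s * (R / r) powr s"
        "K k \<inter> cball x R \<subseteq> (\<Union>c\<in>C. cball c r)"
        using affine_digit_sums_cover[OF s(1) b b2 r, of "p k" "l k" "N k" x] True
        unfolding K_def by auto
      moreover have "(b + 1) * (4 * b) powr s * (R / r) powr s \<le> M * (R / r) powr s"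
        by (intro mult_right_mono) (auto simp: M_def)
      ultimately show ?thesis by (intro exI[of _ C]) auto
    next
      case False
      then have l: "\<bar>l k\<bar> \<ge> 1/4" using alt by blast
      have "real (card (K k \<inter> cball x R)) \<le> 2 * R / \<bar>l k\<bar> + 1"
        unfolding K_def using l R B by (intro card_affine_digit_sums_le) auto
      also have "2 * R / \<bar>l k\<bar> \<le> 2 * 1 / (1/4)" using l R by (intro frac_le) auto
      also have "2 * 1 / (1/4) + 1 \<le> (9::real) * 1" by simp
      also have "\<dots> \<le> M * (R / r) powr s" using M Rr by (intro mult_mono) auto
      finally show ?thesis using r
        by (intro exI[of _ "K k \<inter> cball x R"]) (auto simp: K_def finite_digit_sums intro!: bexI)
    qed
    ultimately show ?thesis unfolding r_def[symmetric]
      using covering_number_le by (metis of_nat_le_iff order.trans)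
  qed
  have low: "s \<le> \<alpha>"
    if C: "C > 0" "\<And>R x. 0 < R \<Longrightarrow> R < 1 \<Longrightarrow> x \<in> (\<Union>k. K k) \<Longrightarrow>
      real (covering_number (R powr (1 / \<theta>)) ((\<Union>k. K k) \<inter> cball x R))
      \<le> C * (R / R powr (1 / \<theta>)) powr \<alpha>" for C \<alpha>
  proof (rule ccontr)
    assume "\<not> s \<le> \<alpha>"
    \<comment> \<open>With \<open>R = (b ^ n) powr (- g)\<close> and
      \<open>r = R powr (1 / \<theta>)\<close> this exponent makes \<open>R / r = b ^ n\<close>, so
      a cluster of \<open>n\<close> digits dilated by at most \<open>r\<close> fits into a ball of
      radius \<open>R\<close>.\<close>
    define g where "g = 1 / (1 / \<theta> - 1)"
    have "1 / \<theta> > 1" using \<theta> by simp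
    then have g: "g > 0" by (simp add: g_def)
    \<comment> \<open>The condition on \<open>n\<close> makes \<open>R < 1/4\<close>, so that
      \<open>rich\<close> applies at \<open>r\<close>. The cluster found has \<open>2 ^ n\<close>
      points, at most 5 of them in any ball of radius \<open>r\<close>, because
      \<open>\<bar>l k\<bar> \<ge> r / 2\<close>.\<close>
    have bound: "2 ^ n \<le> 5 * C * (b ^ n) powr \<alpha>" if n: "b ^ n > 4 powr (1 / g)" for n
    proof -
      define R where "R = (b ^ n) powr (- g)"
      define r where "r = R powr (1 / \<theta>)"
      have bn: "b ^ n > 0" using b2 by simp
      have R0: "0 < R" using b2 by (simp add: R_def)
      have "4 = (4 powr (1 / g)) powr g" using g by (simp add: powr_powr)
      also have "\<dots> < (b ^ n) powr g" using n g by (intro powr_less_mono2) auto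
      finally have R: "R < 1/4" unfolding R_def powr_minus by (simp add: inverse_eq_divide divide_less_eq)
      have "R powr (1 / \<theta>) \<le> R powr 1" using R0 R \<theta> by (intro powr_mono') auto
      then have r: "0 < r" "r \<le> 1/4" using R R0 by (auto simp: r_def)
      have "R / r = R powr (1 - 1 / \<theta>)" using R0 by (simp add: r_def powr_diff)
      also have "\<dots> = (b ^ n) powr (- g * (1 - 1 / \<theta>))" by (simp add: R_def powr_powr)
      also have "- g * (1 - 1 / \<theta>) = g * (1 / \<theta> - 1)" by (simp add: algebra_simps)
      also have "\<dots> = 1" using \<theta> by (simp add: g_def)
      finally have Rr: "R / r = b ^ n" using bn by simp
      obtain k where k: "B k = b" "N k = n" "r / 2 \<le> \<bar>l k\<bar>" "\<bar>l k\<bar> \<le> r"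
        using rich[OF r] by blast
      have x: "p k \<in> K k" unfolding K_def using zero_in_digit_sums by force
      have in_ball: "K k \<subseteq> cball (p k) R"
      proof
        fix y assume "y \<in> K k"
        then obtain e where e: "e \<in> digit_sums b n" "y = p k + l k * e" by (auto simp: K_def k)
        have "\<bar>l k\<bar> * \<bar>e\<bar> \<le> r * b ^ n" using k r digit_sums_bounds[OF b2 e(1)]
          by (intro mult_mono) auto
        also have "\<dots> = R" using Rr r by (simp add: field_simps)
        finally show "y \<in> cball (p k) R" by (simp add: e dist_real_def abs_mult)
      qed
      have "bounded ((\<Union>k. K k) \<inter> cball (p k) R)" by (simp add: bounded_Int)
      from covering_number_attained[OF this r(1)]
      obtain D where D: "finite D" "card D = covering_number r ((\<Union>k. K k) \<inter> cball (p k) R)"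
        "(\<Union>k. K k) \<inter> cball (p k) R \<subseteq> (\<Union>c\<in>D. cball c r)" .
      have "K k \<subseteq> (\<Union>c\<in>D. K k \<inter> cball c r)" using in_ball D(3) by blast
      then have "card (K k) \<le> card (\<Union>c\<in>D. K k \<inter> cball c r)"
        using D(1) by (intro card_mono) (auto simp: K_def finite_digit_sums)
      also have "\<dots> \<le> (\<Sum>c\<in>D. card (K k \<inter> cball c r))" by (intro card_UN_le D(1))
      finally have "real (card (K k)) \<le> (\<Sum>c\<in>D. real (card (K k \<inter> cball c r)))"
        by (metis of_nat_le_iff of_nat_sum)
      also have "\<dots> \<le> (\<Sum>c\<in>D. 5)"
      proof (rule sum_mono)
        fix c
        have "real (card (K k \<inter> cball c r)) \<le> 2 * r / \<bar>l k\<bar> + 1"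
          unfolding K_def using k r B by (intro card_affine_digit_sums_le) auto
        also have "2 * r / \<bar>l k\<bar> \<le> 2 * r / (r / 2)" using k r by (intro divide_left_mono) auto
        also have "2 * r / (r / 2) + 1 = 5" using r by simp
        finally show "real (card (K k \<inter> cball c r)) \<le> 5" by simp
      qed
      also have "\<dots> = 5 * real (covering_number r ((\<Union>k. K k) \<inter> cball (p k) R))"
        using D(2) by simp
      also have "\<dots> \<le> 5 * (C * (R / r) powr \<alpha>)"
        using C(2)[of R "p k"] R0 R x unfolding r_def by auto
      finally have "real (card (K k)) \<le> 5 * C * (b ^ n) powr \<alpha>" by (simp add: Rr)
      moreover have "card (K k) = 2 ^ n"
        unfolding K_def using k r card_digit_sums[OF b2]
        by (subst card_image) (auto simp: inj_on_def)
      ultimately show ?thesis by simp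
    qed
    \<comment> \<open>As \<open>b powr s = 2\<close>, \<open>q\<close> is the growth rate of
      \<open>2 ^ n\<close> against \<open>(b ^ n) powr \<alpha>\<close>; for
      \<open>\<alpha> < s\<close> it exceeds 1, and \<open>q ^ n\<close> outgrows
      \<open>5 * C\<close>.\<close>
    define q where "q = 2 powr (1 - \<alpha> / s)"
    have q: "q > 1" using \<open>\<not> s \<le> \<alpha>\<close> s by (simp add: q_def)
    have pw: "2 ^ n = q ^ n * (b ^ n) powr \<alpha>" for n
    proof -
      have "(b ^ n) powr \<alpha> = 2 powr (real n * (\<alpha> / s))"
        using s by (simp add: b powr_powr flip: powr_realpow)
      moreover have "q ^ n = 2 powr (real n * (1 - \<alpha> / s))"
        by (simp add: q_def powr_powr mult.commute flip: powr_realpow)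
      ultimately have "q ^ n * (b ^ n) powr \<alpha> = 2 powr (real n * (1 - \<alpha> / s) + real n * (\<alpha> / s))"
        by (simp add: powr_add)
      also have "real n * (1 - \<alpha> / s) + real n * (\<alpha> / s) = real n" by (simp add: algebra_simps)
      finally show ?thesis by (simp add: powr_realpow)
    qed
    obtain n1 where n1: "q ^ n1 > 5 * C" using real_arch_pow[OF q] by blast
    obtain n2 where n2: "b ^ n2 > 4 powr (1 / g)" using real_arch_pow[of b] b2 by auto
    define n where "n = max n1 n2"
    have "q ^ n1 \<le> q ^ n" "b ^ n2 \<le> b ^ n" using q b2 by (auto simp: n_def intro!: power_increasing)
    then have 1: "q ^ n > 5 * C" and "b ^ n > 4 powr (1 / g)" using n1 n2 by auto
    then have "q ^ n * (b ^ n) powr \<alpha> \<le> 5 * C * (b ^ n) powr \<alpha>" using bound pw by metis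
    moreover have "(b ^ n) powr \<alpha> > 0" using b2 by simp
    ultimately show False using 1 by simp
  qed
  show ?thesis unfolding assouad_spectrum_def
  proof (rule cInf_eq_minimum)
    show "s \<in> {\<alpha>. 0 \<le> \<alpha> \<and> (\<exists>C>0. \<forall>R x. 0 < R \<and> R < 1 \<and> x \<in> (\<Union>k. K k) \<longrightarrow>
      real (covering_number (R powr (1 / \<theta>)) ((\<Union>k. K k) \<inter> cball x R))
      \<le> C * (R / R powr (1 / \<theta>)) powr \<alpha>)}"
      using s M by (intro CollectI conjI exI[of _ M] allI impI up) auto
  next
    fix \<alpha> assume "\<alpha> \<in> {\<alpha>. 0 \<le> \<alpha> \<and> (\<exists>C>0. \<forall>R x. 0 < R \<and> R < 1 \<and> x \<in> (\<Union>k. K k) \<longrightarrow>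
      real (covering_number (R powr (1 / \<theta>)) ((\<Union>k. K k) \<inter> cball x R))
      \<le> C * (R / R powr (1 / \<theta>)) powr \<alpha>)}"
    then obtain C where C: "C > 0" "\<forall>R x. 0 < R \<and> R < 1 \<and> x \<in> (\<Union>k. K k) \<longrightarrow>
      real (covering_number (R powr (1 / \<theta>)) ((\<Union>k. K k) \<inter> cball x R))
      \<le> C * (R / R powr (1 / \<theta>)) powr \<alpha>" by (elim CollectE conjE exE)
    show "s \<le> \<alpha>" by (rule low[OF C(1) C(2)[rule_format, OF conjI[OF _ conjI]]])
  qed
qed


section \<open>Rational slopes and lines near the coordinate axes\<close>

text \<open>The expression \<open>q * c + d\<close> vanishes at \<open>- d / c\<close>; a rational
  slightly to the right gives a small value of prescribed size. The gap
  \<open>\<bar>c\<bar> - \<bar>d\<bar> > r\<close> keeps it inside (-1, 1).\<close>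

lemma rational_slope_small_inner:
  fixes c d r :: real
  assumes "0 < r" "r < \<bar>c\<bar> - \<bar>d\<bar>"
  obtains q where "q \<in> \<rat>" "-1 < q" "q < 1" "r / 2 \<le> \<bar>q * c + d\<bar>" "\<bar>q * c + d\<bar> \<le> r"
proof -
  have c: "\<bar>c\<bar> > 0" using assms by linarith
  have "- d / c + r / 2 / \<bar>c\<bar> < - d / c + r / \<bar>c\<bar>"
    using assms c by (intro add_strict_left_mono divide_strict_right_mono) auto
  then obtain q where q: "q \<in> \<rat>" "- d / c + r / 2 / \<bar>c\<bar> < q" "q < - d / c + r / \<bar>c\<bar>"
    using Rats_dense_in_real by blast
  define h where "h = q + d / c"
  have h: "r / 2 / \<bar>c\<bar> < h" "h < r / \<bar>c\<bar>" "0 < h" using q assms c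
    by (auto simp: h_def intro: less_trans[of 0 "r / 2 / \<bar>c\<bar>"])
  have eq: "q * c + d = h * c" using c by (simp add: h_def field_simps)
  have "r / 2 < h * \<bar>c\<bar>" "h * \<bar>c\<bar> < r" using h c by (simp_all add: field_simps)
  then have 1: "r / 2 \<le> \<bar>q * c + d\<bar>" "\<bar>q * c + d\<bar> \<le> r" using h by (auto simp: eq abs_mult)
  have "\<bar>q\<bar> * \<bar>c\<bar> \<le> \<bar>q * c + d\<bar> + \<bar>d\<bar>" by (simp flip: abs_mult)
  also have "\<dots> < 1 * \<bar>c\<bar>" using 1 assms by simp
  finally have "\<bar>q\<bar> < 1" using c by (simp only: mult_less_cancel_right_pos)
  then show ?thesis using that q(1) 1 by auto
qed

lemma inner_cart_2:
  fixes x y :: "real^2"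
  assumes "i \<noteq> j"
  shows "x \<bullet> y = x $ i * y $ i + x $ j * y $ j"
  using assms exhaust_2[of i] exhaust_2[of j] by (auto simp: inner_vec_def sum_2)

text \<open>The bounds come from \<open>cos (pi / 6) = sqrt 3 / 2 > 4/5\<close> and
  \<open>sin (pi / 6) = 1/2\<close>. Their difference \<open>4/5 - 1/2\<close> exceeds 1/4, the
  threshold used for the projections.\<close>

lemma abs_components_if_angle_small:
  assumes V: "V \<in> G21" and i: "line_angle (span {axis i 1}) V < pi / 6" and "j \<noteq> i"
  shows "\<bar>unit_dir V $ i\<bar> > 4/5" "\<bar>unit_dir V $ j\<bar> < 1/2"
proof -
  let ?A = "span {axis i (1::real)} :: (real^2) set" and ?u = "unit_dir V"
  have A: "?A \<in> G21" by (simp add: G21_def dim_insert)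
  obtain k where k: "unit_dir ?A = k *\<^sub>R axis i 1"
    using unit_dir_in[OF A] by (auto simp: span_singleton)
  then have "\<bar>k\<bar> = 1" using norm_unit_dir[OF A] by simp
  then have abs: "\<bar>unit_dir ?A \<bullet> ?u\<bar> = \<bar>?u $ i\<bar>" by (simp add: k abs_mult inner_axis')
  have le: "\<bar>?u $ i\<bar> \<le> 1" using component_le_norm_cart[of ?u i] norm_unit_dir[OF V] by simp
  have "arccos \<bar>?u $ i\<bar> < pi / 6" using i A V by (simp add: line_angle_def abs)
  then have "cos (pi / 6) < cos (arccos \<bar>?u $ i\<bar>)"
    using le by (intro cos_monotone_0_pi) (auto intro!: arccos_lbound)
  then have gt: "sqrt 3 / 2 < \<bar>?u $ i\<bar>" using le by (simp add: cos_30)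
  have "8/5 \<le> sqrt (3::real)" by (rule real_le_rsqrt) (simp add: power2_eq_square)
  then show "\<bar>?u $ i\<bar> > 4/5" using gt by simp
  have "(?u $ i)\<^sup>2 + (?u $ j)\<^sup>2 = 1"
    using norm_unit_dir[OF V] inner_cart_2[of i j ?u ?u] assms(3) by (simp add: norm_eq_1 power2_eq_square)
  moreover have "(sqrt 3 / 2)\<^sup>2 < \<bar>?u $ i\<bar>\<^sup>2" using gt by (intro power_strict_mono) auto
  ultimately have "\<bar>?u $ j\<bar>\<^sup>2 < (1/2)\<^sup>2" by (simp add: power_divide)
  then show "\<bar>?u $ j\<bar> < 1/2" by (rule power_less_imp_less_base) simp
qed

section \<open>Construction of the planar set and analysis of its projections\<close>

theorem theorem2p9:
  fixes s t :: real
  assumes "0 < s" and "s < t" and "t \<le> 1"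
  shows "\<exists>(X :: (real^2) set) I\<^sub>s I\<^sub>t.
    uniform_discrete X \<and> \<not> bounded X \<and>
    openin G21_topology I\<^sub>s \<and> openin G21_topology I\<^sub>t \<and>
    I\<^sub>s \<noteq> {} \<and> I\<^sub>t \<noteq> {} \<and> I\<^sub>s \<inter> I\<^sub>t = {} \<and>
    (\<forall>\<theta>\<in>{0<..<1}. \<forall>V\<in>I\<^sub>s. assouad_spectrum \<theta> (line_proj V ` X) = s) \<and>
    (\<forall>\<theta>\<in>{0<..<1}. \<forall>V\<in>I\<^sub>t. assouad_spectrum \<theta> (line_proj V ` X) = t)"
proof -
  \<comment> \<open>A triple records an axis, a number of digits and a rational slope;
    \<open>f\<close> runs through all triples, so every combination occurs as a copy.\<close>
  define Q :: "(2 \<times> nat \<times> real) set" where "Q = UNIV \<times> UNIV \<times> (\<rat> \<inter> {-1<..<1})"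
  have "countable Q" unfolding Q_def by (intro countable_SIGMA countable_Int1 countable_rat) auto
  moreover have "Q \<noteq> {}" by (auto simp: Q_def intro!: exI[of _ 0])
  ultimately obtain f :: "nat \<Rightarrow> 2 \<times> nat \<times> real" where f: "range f = Q"
    using range_from_nat_into by metis
  define a N q where "a k = fst (f k)" and "N k = fst (snd (f k))" and "q k = snd (snd (f k))" for k
  have q: "\<bar>q k\<bar> < 1" for k
    using f rangeI[of f k] by (auto simp: q_def Q_def)
  \<comment> \<open>\<open>\<sigma> i\<close> will be the spectrum seen by lines near axis
    \<open>i\<close>.\<close>
  define \<sigma> where "\<sigma> i = (if i = (1::2) then t else s)" for i
  have \<sigma>: "0 < \<sigma> i" "\<sigma> i \<le> 1" for i using assms by (auto simp: \<sigma>_def)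
  define B where "B k = 2 powr (1 / \<sigma> (a k))" for k
  have B: "B k \<ge> 2" for k unfolding B_def by (intro two_powr_inverse_ge_2 \<sigma>)
  \<comment> \<open>The slope sits in coordinate \<open>a k\<close>, so the direction lies in the
    cone around the other axis and can be almost orthogonal to a line near axis
    \<open>a k\<close>.\<close>
  define w :: "nat \<Rightarrow> real^2" where "w k = (\<chi> j. if j = a k then q k else 1)" for k
  \<comment> \<open>Bounds the extent of a copy along any unit vector: its digit sums stay below
    \<open>B k ^ N k\<close>, and \<open>norm (w k) \<le> 2\<close>.\<close>
  define D where "D k = 2 * B k ^ N k" for k
  have D: "D k > 0" for k using B[of k] by (simp add: D_def)
  \<comment> \<open>Positions \<open>j < k\<close> differ by at least
    \<open>4 * (D j + D k + 1)\<close>; the factor 4 makes up for a projection that multiplies the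
    diagonal by a factor as small as 1/4.\<close>
  define x where "x k = 4 * (\<Sum>j<k. 2 * D j + 1) + 4 * D k" for k
  have x_diff: "x k - x j \<ge> 4 * (D j + D k + 1)" if "j < k" for j k
  proof -
    have "(\<Sum>i<Suc j. 2 * D i + 1) \<le> (\<Sum>i<k. 2 * D i + 1)"
      using that D[THEN less_imp_le] by (intro sum_mono2) auto
    then show ?thesis by (simp add: x_def)
  qed
  define K where "K k = (\<lambda>e. x k *\<^sub>R 1 + e *\<^sub>R w k) ` digit_sums (B k) (N k)" for k
  \<comment> \<open>Here \<open>1\<close> is the diagonal vector. The projected gap is at least
    \<open>D j + D k + 1\<close>, of which the two copies use up at most
    \<open>D j + D k\<close>.\<close>
  have far: "\<bar>(y - z) \<bullet> u\<bar> \<ge> 1"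
    if u: "norm u = 1" "\<bar>1 \<bullet> u\<bar> \<ge> 1/4" and "j \<noteq> k" "y \<in> K j" "z \<in> K k" for u j k y z
    using that(3-)
  proof (induction j k arbitrary: y z rule: linorder_wlog)
    case (le j k)
    then have x: "x k - x j \<ge> 4 * (D j + D k + 1)" by (intro x_diff) auto
    obtain e g where eg: "e \<in> digit_sums (B j) (N j)" "y = x j *\<^sub>R 1 + e *\<^sub>R w j"
      "g \<in> digit_sums (B k) (N k)" "z = x k *\<^sub>R 1 + g *\<^sub>R w k" using le by (auto simp: K_def)
    have small: "\<bar>e * (w k \<bullet> u)\<bar> \<le> D k" if "e \<in> digit_sums (B k) (N k)" for e k
    proof -
      have "norm (w k) \<le> (\<Sum>i\<in>UNIV. \<bar>w k $ i\<bar>)" by (rule norm_le_l1_cart)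
      also have "\<dots> \<le> (\<Sum>i\<in>(UNIV::2 set). 1)" using q[of k] by (intro sum_mono) (auto simp: w_def)
      finally have "\<bar>w k \<bullet> u\<bar> \<le> 2" using Cauchy_Schwarz_ineq2[of "w k" u] u by simp
      then have "\<bar>e\<bar> * \<bar>w k \<bullet> u\<bar> \<le> B k ^ N k * 2"
        using digit_sums_bounds[OF B that] by (intro mult_mono) auto
      then show ?thesis by (simp add: D_def abs_mult)
    qed
    have "4 * (D j + D k + 1) * (1/4) \<le> \<bar>x k - x j\<bar> * \<bar>1 \<bullet> u\<bar>"
      using u x D[of j] D[of k] by (intro mult_mono) auto
    then have "D j + D k + 1 \<le> \<bar>(x k - x j) * (1 \<bullet> u)\<bar>" by (simp add: abs_mult)
    moreover have "(z - y) \<bullet> u = (x k - x j) * (1 \<bullet> u) + (g * (w k \<bullet> u) - e * (w j \<bullet> u))"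
      by (simp add: eg inner_simps algebra_simps)
    ultimately have "\<bar>(z - y) \<bullet> u\<bar> \<ge> 1" using small[OF eg(1)] small[OF eg(3)] by linarith
    then show ?case by (simp add: inner_diff_left abs_minus_commute)
  next
    case (sym j k)
    then have "\<bar>(z - y) \<bullet> u\<bar> \<ge> 1" by metis
    then show ?case by (simp add: inner_diff_left abs_minus_commute)
  qed
  define X where "X = (\<Union>k. K k)"
  have discrete: "uniform_discrete X"
  proof (rule uniformI2)
    fix y z assume yz: "y \<in> X" "z \<in> X" "y \<noteq> z"
    then obtain j k where jk: "y \<in> K j" "z \<in> K k" by (auto simp: X_def)
    show "dist y z \<ge> 1"
    proof (cases "j = k")
      case False
      have "\<bar>(y - z) \<bullet> axis 1 1\<bar> \<ge> 1"
        by (rule far[OF _ _ False jk]) (simp_all add: inner_axis)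
      then show ?thesis using Cauchy_Schwarz_ineq2[of "y - z" "axis 1 1"] by (simp add: dist_norm)
    next
      case True
      obtain e g where eg: "e \<in> digit_sums (B k) (N k)" "y = x k *\<^sub>R 1 + e *\<^sub>R w k"
        "g \<in> digit_sums (B k) (N k)" "z = x k *\<^sub>R 1 + g *\<^sub>R w k" using jk True by (auto simp: K_def)
      \<comment> \<open>In the coordinate other than \<open>a k\<close> the direction has entry 1,
        so the copy appears there undilated.\<close>
      obtain i where "i \<noteq> a k" using exhaust_2[of "a k"] by (metis zero_neq_one)
      then have "(y - z) $ i = e - g" by (simp add: eg w_def)
      moreover have "e \<noteq> g" using yz eg by auto
      ultimately have "\<bar>(y - z) $ i\<bar> \<ge> 1" using digit_sums_separated[OF B eg(1,3)] by simp
      then show ?thesis using component_le_norm_cart[of "y - z" i] by (simp add: dist_norm)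
    qed
  qed simp
  have unbounded: "\<not> bounded X"
  proof
    assume "bounded X"
    then obtain M where M: "\<And>y. y \<in> X \<Longrightarrow> norm y \<le> M" by (auto simp: bounded_iff)
    obtain k :: nat where k: "real k > M" using reals_Archimedean2 by blast
    have "x k *\<^sub>R 1 \<in> X" using zero_in_digit_sums by (force simp: X_def K_def)
    then have "\<bar>x k\<bar> \<le> M"
      using order.trans[OF component_le_norm_cart[of "x k *\<^sub>R 1" 1] M] by simp
    moreover have "(\<Sum>j<k. 1) \<le> (\<Sum>j<k. 2 * D j + 1)"
      using D by (intro sum_mono) (simp add: less_imp_le)
    ultimately show False using k D[of k] by (simp add: x_def)
  qed
  define J where "J i = G21.mball (span {axis i 1}) (pi / 6)" for i :: 2
  have "span {axis i 1} \<in> G21" for i :: 2 by (simp add: G21_def dim_insert)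
  then have "span {axis i 1} \<in> J i" for i by (simp add: J_def)
  then have nonempty: "J i \<noteq> {}" for i by blast
  have opens: "openin G21_topology (J i)" for i by (simp add: J_def)
  have J: "V \<in> G21" "\<bar>unit_dir V $ i\<bar> > 4/5" "\<bar>unit_dir V $ j\<bar> < 1/2"
    if "V \<in> J i" "j \<noteq> i" for V i j
    using that abs_components_if_angle_small[of V i j] by (auto simp: J_def)
  have disj: "J 2 \<inter> J 1 = {}" using J(2)[of _ 1 2] J(3)[of _ 2 1] by fastforce
  have spectrum: "assouad_spectrum \<theta> (line_proj V ` X) = \<sigma> i"
    if \<theta>: "\<theta> \<in> {0<..<1}" and V: "V \<in> J i" for \<theta> V i
  proof -
    define u where "u = unit_dir V"
    obtain h where h: "h \<noteq> i" using exhaust_2[of i] by (metis zero_neq_one)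
    have VG: "V \<in> G21" and u: "\<bar>u $ i\<bar> > 4/5" "\<bar>u $ h\<bar> < 1/2" "norm u = 1"
      using J[OF V h] norm_unit_dir by (auto simp: u_def)
    have "1 \<bullet> u = u $ h + u $ i" by (simp add: inner_cart_2[OF h])
    then have u1: "\<bar>1 \<bullet> u\<bar> \<ge> 1/4" using u(1,2) by linarith
    \<comment> \<open>This is the dilation factor of copy \<open>k\<close> on the line. Only for
      \<open>a k = i\<close> does the slope multiply the large component \<open>u $ i\<close>, so
      only then can the two terms cancel.\<close>
    have w: "w k \<bullet> u = (if a k = i then q k * u $ i + u $ h else u $ i + q k * u $ h)" for k
    proof -
      have "a k = i \<or> a k = h" using h exhaust_2 by metis
      then show ?thesis using h by (auto simp: inner_cart_2[OF h] w_def)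
    qed
    define L where "L k = (\<lambda>e. x k * (1 \<bullet> u) + (w k \<bullet> u) * e) ` digit_sums (B k) (N k)" for k
    have L: "L k = (\<lambda>y. y \<bullet> u) ` K k" for k
      by (auto simp: L_def K_def image_image inner_simps mult.commute)
    have "assouad_spectrum \<theta> (\<Union>k. L k) = \<sigma> i"
      unfolding L_def
    proof (rule assouad_spectrum_clusters[OF \<sigma> refl])
      show "1 \<le> \<bar>y - z\<bar>" if "j \<noteq> k"
        "y \<in> (\<lambda>e. x j * (1 \<bullet> u) + (w j \<bullet> u) * e) ` digit_sums (B j) (N j)"
        "z \<in> (\<lambda>e. x k * (1 \<bullet> u) + (w k \<bullet> u) * e) ` digit_sums (B k) (N k)" for j k y z
        using that far[OF u(3) u1] unfolding L_def[symmetric] L by (auto simp: inner_diff_left)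
      show "B k = 2 powr (1 / \<sigma> i) \<or> 1/4 \<le> \<bar>w k \<bullet> u\<bar>" for k
      proof (cases "a k = i")
        case False
        have "\<bar>q k * u $ h\<bar> \<le> 1 * (1/2)"
          unfolding abs_mult using q[of k] u by (intro mult_mono) auto
        then have "1/4 \<le> \<bar>u $ i + q k * u $ h\<bar>" using u(1) by linarith
        then show ?thesis using False by (simp add: w)
      qed (simp add: B_def)
      show "\<exists>k. B k = 2 powr (1 / \<sigma> i) \<and> N k = m \<and> r / 2 \<le> \<bar>w k \<bullet> u\<bar> \<and> \<bar>w k \<bullet> u\<bar> \<le> r"
        if r: "0 < r" "r \<le> 1/4" for m r
      proof -
        \<comment> \<open>The slope lemma applies because
          \<open>r \<le> 1/4 < \<bar>u $ i\<bar> - \<bar>u $ h\<bar>\<close>; surjectivity of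
          \<open>f\<close> then supplies a copy with this slope and exactly \<open>m\<close>
          digits.\<close>
        obtain c where c: "c \<in> \<rat>" "-1 < c" "c < 1" "r / 2 \<le> \<bar>c * u $ i + u $ h\<bar>"
          "\<bar>c * u $ i + u $ h\<bar> \<le> r"
          using rational_slope_small_inner[of r "u $ i" "u $ h"] r u by auto
        have "(i, m, c) \<in> range f" using c by (simp add: f Q_def)
        then obtain k where "f k = (i, m, c)" by force
        then have "a k = i" "N k = m" "q k = c" by (auto simp: a_def N_def q_def)
        then show ?thesis using c by (auto simp: w B_def)
      qed
    qed (use \<theta> B in auto)
    moreover have "line_proj V ` X = (\<Union>k. L k)"
      by (auto simp: X_def L line_proj_eq[OF VG] u_def image_UN)
    ultimately show ?thesis by simp
  qed
  show ?thesis
    using discrete unbounded opens nonempty disj spectrum[of _ _ 2] spectrum[of _ _ 1]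
    by (intro exI[of _ X] exI[of _ "J 2"] exI[of _ "J 1"]) (simp add: \<sigma>_def)
qed

end
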